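(* Let $L$ be a residuated lattice, $n\geq 1$ an integer, and $F$ a filter of $L$. Then $F$ is an $n$-fold positive implicative filter of $L$ if and only if $F$ is both an $n$-fold fantastic filter and an $n$-fold implicative filter of $L$.
   Context: A residuated lattice is an algebra $(L,\wedge,\vee,\otimes,\rightarrow,0,1)$ such that $(L,\wedge,\vee,0,1)$ is a bounded lattice, $(L,\otimes,1)$ is a commutative monoid, and $x\otimes y\leq z$ iff $x\leq y\rightarrow z$. A filter of $L$ is a nonempty subset closed under $\otimes$ and upward closed. For $x\in L$, $x^n=x\otimes\cdots\otimes x$ ($n$ factors). A subset $F\subseteq L$ is: - an $n$-fold positive implicative filter if $1\in F$ and for all $x,y,z\in L$: $x\rightarrow((y^n\rightarrow z)\rightarrow y)\in F$ and $x\in F$ imply $y\in F$; - an $n$-fold implicative filter if $1\in F$ and for all $x,y,z\in L$: $x^n\rightarrow(y\rightarrow z)\in F$ and $x^n\rightarrow y\in F$ imply $x^n\rightarrow z\in F$; - an $n$-fold fantastic filter if $1\in F$ and for all $x,y\in L$: $y\rightarrow x\in F$ implies $((x^n\rightarrow y)\rightarrow y)\rightarrow x\in F$. *)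

theory Defs
  imports Main
begin

text \<open>
  The bounded lattice constants \<open>0\<close>, \<open>1\<close> of the algebra are \<open>bot\<close> and \<open>top\<close>, and the monoid
  operation \<open>\<otimes>\<close> is the multiplication of \<open>comm_monoid_mult\<close>, so that \<open>x ^ n\<close> is
  the library power. The lattice top and the monoid unit are the same constant of
  the algebra, which is what \<open>one_eq_top\<close> expresses.
\<close>

class residuated_lattice = bounded_lattice + comm_monoid_mult +
  fixes residuum :: "'a \<Rightarrow> 'a \<Rightarrow> 'a"  (infixr "\<^bold>\<rightarrow>" 60)
  assumes one_eq_top: "1 = top"
    and residuation: "x * y \<le> z \<longleftrightarrow> x \<le> y \<^bold>\<rightarrow> z"

definition rl_filter :: "'a::residuated_lattice set \<Rightarrow> bool" where
  "rl_filter F \<longleftrightarrow>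
     F \<noteq> {} \<and>
     (\<forall>x\<in>F. \<forall>y\<in>F. x * y \<in> F) \<and>
     (\<forall>x\<in>F. \<forall>y. x \<le> y \<longrightarrow> y \<in> F)"

definition nfold_positive_implicative_filter :: "nat \<Rightarrow> 'a::residuated_lattice set \<Rightarrow> bool" where
  "nfold_positive_implicative_filter n F \<longleftrightarrow>
     1 \<in> F \<and>
     (\<forall>x y z. x \<^bold>\<rightarrow> ((y ^ n \<^bold>\<rightarrow> z) \<^bold>\<rightarrow> y) \<in> F \<longrightarrow> x \<in> F \<longrightarrow> y \<in> F)"

definition nfold_implicative_filter :: "nat \<Rightarrow> 'a::residuated_lattice set \<Rightarrow> bool" where
  "nfold_implicative_filter n F \<longleftrightarrow>
     1 \<in> F \<and>
     (\<forall>x y z. x ^ n \<^bold>\<rightarrow> (y \<^bold>\<rightarrow> z) \<in> F \<longrightarrow> x ^ n \<^bold>\<rightarrow> y \<in> F \<longrightarrow> x ^ n \<^bold>\<rightarrow> z \<in> F)"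

definition nfold_fantastic_filter :: "nat \<Rightarrow> 'a::residuated_lattice set \<Rightarrow> bool" where
  "nfold_fantastic_filter n F \<longleftrightarrow>
     1 \<in> F \<and>
     (\<forall>x y. y \<^bold>\<rightarrow> x \<in> F \<longrightarrow> ((x ^ n \<^bold>\<rightarrow> y) \<^bold>\<rightarrow> y) \<^bold>\<rightarrow> x \<in> F)"

end

theory Submission
  imports Defs
begin

text \<open>
  Read membership in \<open>F\<close> as equality to \<open>1\<close> in the quotient \<open>L / F\<close>.  The implicative condition
  then says that \<open>x ^ n = x ^ (2 * n)\<close> for all \<open>x\<close>, and the positive implicative condition says
  that \<open>(y ^ n \<rightarrow> z) \<le> y\<close> forces \<open>y = 1\<close>.  The latter applied to \<open>y \<or> (y ^ n \<rightarrow> z)\<close> gives the law of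
  excluded middle \<open>y \<or> (y ^ n \<rightarrow> z) = 1\<close>; its \<open>n\<close>-th power, for \<open>z = y ^ (2 * n)\<close>, is the
  implicative condition.  The fantastic condition follows by applying the positive implicative one to
  \<open>((x ^ n \<rightarrow> y) \<rightarrow> y) \<rightarrow> x\<close>.  Conversely, with \<open>p = y ^ n \<rightarrow> z\<close>, idempotence of \<open>y ^ n\<close> gives
  \<open>y ^ n \<rightarrow> p = p\<close>, so that the fantastic condition for \<open>p \<le> y\<close> yields \<open>y = 1\<close>.
\<close>

context residuated_lattice
begin

lemma le_one: "x \<le> 1"
  by (simp add: one_eq_top)

lemma mult_right_mono_rl: "x \<le> y \<Longrightarrow> x * z \<le> y * z"
  by (meson order_refl order_trans residuation)

lemma mult_mono_rl: "x \<le> y \<Longrightarrow> z \<le> w \<Longrightarrow> x * z \<le> y * w"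
  by (metis mult.commute mult_right_mono_rl order_trans)

lemma power_mono_rl: "x \<le> y \<Longrightarrow> x ^ k \<le> y ^ k"
  by (induction k) (auto intro: mult_mono_rl)

lemma residuum_mult_le: "(x \<^bold>\<rightarrow> y) * x \<le> y"
  by (simp add: residuation)

lemma residuum_mono: "x' \<le> x \<Longrightarrow> y \<le> y' \<Longrightarrow> x \<^bold>\<rightarrow> y \<le> x' \<^bold>\<rightarrow> y'"
  by (meson mult_mono_rl order_refl order_trans residuation residuum_mult_le)

lemma one_le_residuum_iff: "1 \<le> x \<^bold>\<rightarrow> y \<longleftrightarrow> x \<le> y"
  by (simp flip: residuation)

lemma le_residuum: "y \<le> x \<^bold>\<rightarrow> y"
  by (metis le_one mult_1_right mult_mono_rl order_refl residuation)

text \<open>By residuation and associativity both sides have the same lower bounds.\<close>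

lemma residuum_residuum: "x \<^bold>\<rightarrow> (y \<^bold>\<rightarrow> z) = (x * y) \<^bold>\<rightarrow> z"
proof -
  have "w \<le> x \<^bold>\<rightarrow> (y \<^bold>\<rightarrow> z) \<longleftrightarrow> w \<le> (x * y) \<^bold>\<rightarrow> z" for w
    by (simp flip: residuation add: mult.assoc)
  then show ?thesis
    by (meson order.antisym order_refl)
qed

lemma residuum_trans: "(x \<^bold>\<rightarrow> y) * (y \<^bold>\<rightarrow> z) \<le> x \<^bold>\<rightarrow> z"
proof -
  have "(y \<^bold>\<rightarrow> z) * ((x \<^bold>\<rightarrow> y) * x) \<le> z"
    by (meson mult_mono_rl order_refl order_trans residuum_mult_le)
  then show ?thesis
    by (simp flip: residuation add: mult_ac)
qed

lemma sup_mult_le: "x * z \<le> w \<Longrightarrow> y * z \<le> w \<Longrightarrow> sup x y * z \<le> w"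
  by (simp add: residuation)

text \<open>Products distribute over joins, and each term of the expansion other than
  \<open>x ^ k\<close> has a factor \<open>y\<close>, so it lies below \<open>y\<close>.\<close>

lemma power_sup_le: "sup x y ^ k \<le> sup (x ^ k) y"
proof (induction k)
  case 0
  then show ?case by simp
next
  case (Suc k)
  have y: "y * u \<le> sup (x ^ Suc k) y" for u
    by (metis le_one le_supI2 mult_1_right mult_mono_rl order_refl)
  have "sup (x ^ k) y * x \<le> sup (x ^ Suc k) y"
    by (intro sup_mult_le y) (simp only: power_Suc2 sup_ge1)
  then have "sup x y * sup (x ^ k) y \<le> sup (x ^ Suc k) y"
    by (intro sup_mult_le y) (simp only: mult.commute)
  then show ?case
    using mult_mono_rl[OF order_refl Suc.IH] by (auto intro: order_trans)
qed

end

lemma rl_filter_upward: "rl_filter F \<Longrightarrow> x \<in> F \<Longrightarrow> x \<le> y \<Longrightarrow> y \<in> F"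
  by (auto simp: rl_filter_def)

lemma rl_filter_mult: "rl_filter F \<Longrightarrow> x \<in> F \<Longrightarrow> y \<in> F \<Longrightarrow> x * y \<in> F"
  by (auto simp: rl_filter_def)

lemma rl_filter_one: "rl_filter F \<Longrightarrow> 1 \<in> F"
  by (metis all_not_in_conv le_one rl_filter_def)

lemma rl_filter_power: "rl_filter F \<Longrightarrow> x \<in> F \<Longrightarrow> x ^ k \<in> F"
  by (induction k) (auto intro: rl_filter_one rl_filter_mult)

lemma rl_filter_residuum_le: "rl_filter F \<Longrightarrow> x \<le> y \<Longrightarrow> x \<^bold>\<rightarrow> y \<in> F"
  by (meson one_le_residuum_iff rl_filter_one rl_filter_upward)

lemma rl_filter_modus_ponens: "rl_filter F \<Longrightarrow> x \<in> F \<Longrightarrow> x \<^bold>\<rightarrow> y \<in> F \<Longrightarrow> y \<in> F"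
  by (meson residuum_mult_le rl_filter_mult rl_filter_upward)

lemma rl_filter_residuum_trans:
  "rl_filter F \<Longrightarrow> x \<^bold>\<rightarrow> y \<in> F \<Longrightarrow> y \<^bold>\<rightarrow> z \<in> F \<Longrightarrow> x \<^bold>\<rightarrow> z \<in> F"
  by (meson residuum_trans rl_filter_mult rl_filter_upward)

text \<open>For \<open>x \<in> F\<close>, modus ponens removes the premise \<open>x\<close>;
  conversely \<open>x = 1\<close> recovers the short form.\<close>

lemma nfold_positive_implicative_filter_iff:
  assumes "rl_filter F"
  shows "nfold_positive_implicative_filter n F \<longleftrightarrow>
           (\<forall>y z. (y ^ n \<^bold>\<rightarrow> z) \<^bold>\<rightarrow> y \<in> F \<longrightarrow> y \<in> F)"
  unfolding nfold_positive_implicative_filter_def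
  by (meson assms le_residuum rl_filter_modus_ponens rl_filter_one rl_filter_upward)

lemma nfold_implicative_filter_iff:
  assumes F: "rl_filter F"
  shows "nfold_implicative_filter n F \<longleftrightarrow> (\<forall>x. x ^ n \<^bold>\<rightarrow> (x ^ n * x ^ n) \<in> F)"
proof
  assume "nfold_implicative_filter n F"
  moreover have "x ^ n \<^bold>\<rightarrow> (x ^ n \<^bold>\<rightarrow> (x ^ n * x ^ n)) \<in> F" "x ^ n \<^bold>\<rightarrow> x ^ n \<in> F" for x
    by (simp_all add: residuum_residuum rl_filter_residuum_le[OF F])
  ultimately show "\<forall>x. x ^ n \<^bold>\<rightarrow> (x ^ n * x ^ n) \<in> F"
    unfolding nfold_implicative_filter_def by blast
next
  assume idem: "\<forall>x. x ^ n \<^bold>\<rightarrow> (x ^ n * x ^ n) \<in> F"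
  have "x ^ n \<^bold>\<rightarrow> z \<in> F" if "x ^ n \<^bold>\<rightarrow> (y \<^bold>\<rightarrow> z) \<in> F" "x ^ n \<^bold>\<rightarrow> y \<in> F" for x y z
  proof -
    have "y \<^bold>\<rightarrow> (x ^ n \<^bold>\<rightarrow> z) \<in> F"
      using that(1) by (simp add: residuum_residuum mult.commute)
    then have "(x ^ n * x ^ n) \<^bold>\<rightarrow> z \<in> F"
      using rl_filter_residuum_trans[OF F that(2)] by (simp flip: residuum_residuum)
    then show ?thesis
      using rl_filter_residuum_trans[OF F] idem by blast
  qed
  then show "nfold_implicative_filter n F"
    unfolding nfold_implicative_filter_def using rl_filter_one[OF F] by blast
qed

lemma positive_implicative_imp_fantastic:
  assumes F: "rl_filter F" and pos: "nfold_positive_implicative_filter n F"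
  shows "nfold_fantastic_filter n F"
proof -
  have "((x ^ n \<^bold>\<rightarrow> y) \<^bold>\<rightarrow> y) \<^bold>\<rightarrow> x \<in> F" if yx: "y \<^bold>\<rightarrow> x \<in> F" for x y
  proof -
    define p where "p = x ^ n \<^bold>\<rightarrow> y"
    define u where "u = (p \<^bold>\<rightarrow> y) \<^bold>\<rightarrow> x"
    \<comment> \<open>Since \<open>x \<le> u\<close> and the residuum is antitone on the
      left.\<close>
    have "u ^ n \<^bold>\<rightarrow> y \<le> p"
      unfolding p_def u_def by (intro residuum_mono power_mono_rl le_residuum order_refl)
    then have "p \<^bold>\<rightarrow> u \<le> (u ^ n \<^bold>\<rightarrow> y) \<^bold>\<rightarrow> u"
      by (simp add: residuum_mono)
    moreover have "y \<^bold>\<rightarrow> x \<le> p \<^bold>\<rightarrow> u"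
      using residuum_trans[of p y x]
      by (simp add: u_def residuum_residuum mult.commute flip: residuation)
         (simp add: residuation residuum_residuum mult_ac)
    ultimately have "(u ^ n \<^bold>\<rightarrow> y) \<^bold>\<rightarrow> u \<in> F"
      using yx rl_filter_upward[OF F] by blast
    then show ?thesis
      using pos unfolding nfold_positive_implicative_filter_iff[OF F] u_def p_def by blast
  qed
  then show ?thesis
    unfolding nfold_fantastic_filter_def using rl_filter_one[OF F] by blast
qed

lemma positive_implicative_excluded_middle:
  assumes F: "rl_filter F" and pos: "nfold_positive_implicative_filter n F"
  shows "sup y (y ^ n \<^bold>\<rightarrow> z) \<in> F"
proof -
  let ?w = "sup y (y ^ n \<^bold>\<rightarrow> z)"
  have "?w ^ n \<^bold>\<rightarrow> z \<le> y ^ n \<^bold>\<rightarrow> z"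
    by (simp add: residuum_mono power_mono_rl)
  then have "(?w ^ n \<^bold>\<rightarrow> z) \<^bold>\<rightarrow> ?w \<in> F"
    by (intro rl_filter_residuum_le[OF F] le_supI2)
  then show ?thesis
    using pos unfolding nfold_positive_implicative_filter_iff[OF F] by blast
qed

lemma positive_implicative_imp_implicative:
  fixes F :: "'a::residuated_lattice set"
  assumes F: "rl_filter F" and pos: "nfold_positive_implicative_filter n F"
  shows "nfold_implicative_filter n F"
  unfolding nfold_implicative_filter_iff[OF F]
proof
  fix x :: 'a
  let ?b = "x ^ n \<^bold>\<rightarrow> (x ^ n * x ^ n)"
  have "x ^ n \<le> ?b"
    by (simp flip: residuation)
  \<comment> \<open>The bound \<open>sup (x ^ n) ?b\<close> collapses to \<open>?b\<close>.\<close>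
  then have "sup x ?b ^ n \<le> ?b"
    using power_sup_le[of x ?b n] by (simp add: sup_absorb2)
  then show "?b \<in> F"
    using positive_implicative_excluded_middle[OF F pos] rl_filter_power[OF F]
      rl_filter_upward[OF F] by blast
qed

lemma fantastic_implicative_imp_positive_implicative:
  fixes F :: "'a::residuated_lattice set"
  assumes F: "rl_filter F" and fan: "nfold_fantastic_filter n F"
    and imp: "nfold_implicative_filter n F"
  shows "nfold_positive_implicative_filter n F"
  unfolding nfold_positive_implicative_filter_iff[OF F]
proof (intro allI impI)
  fix y z :: 'a
  define p where "p = y ^ n \<^bold>\<rightarrow> z"
  assume "(y ^ n \<^bold>\<rightarrow> z) \<^bold>\<rightarrow> y \<in> F"
  then have "((y ^ n \<^bold>\<rightarrow> p) \<^bold>\<rightarrow> p) \<^bold>\<rightarrow> y \<in> F"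
    using fan unfolding nfold_fantastic_filter_def p_def by blast
  moreover have "(y ^ n \<^bold>\<rightarrow> p) \<^bold>\<rightarrow> p \<in> F"
  proof (rule rl_filter_upward[OF F])
    show "y ^ n \<^bold>\<rightarrow> (y ^ n * y ^ n) \<in> F"
      using imp unfolding nfold_implicative_filter_iff[OF F] by blast
    show "y ^ n \<^bold>\<rightarrow> (y ^ n * y ^ n) \<le> (y ^ n \<^bold>\<rightarrow> p) \<^bold>\<rightarrow> p"
      using residuum_trans[of "y ^ n" "y ^ n * y ^ n" z]
      by (simp add: p_def residuum_residuum residuation)
  qed
  ultimately show "y \<in> F"
    using rl_filter_modus_ponens[OF F] by blast
qed

theorem theorem7p8:
  fixes F :: "'a::residuated_lattice set" and n :: nat
  assumes "n \<ge> 1" and "rl_filter F"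
  shows "nfold_positive_implicative_filter n F \<longleftrightarrow>
           nfold_fantastic_filter n F \<and> nfold_implicative_filter n F"
  using assms(2) positive_implicative_imp_fantastic positive_implicative_imp_implicative
    fantastic_implicative_imp_positive_implicative by blast

end
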